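(* Let $U\subset\mathbb{R}^n$ be an open connected domain, let $F=F(x,p)$ be a $C^1$ real-valued function of $(x,p)$, and let $v_1,v_2\in C^2(U)$ be uniformly convex solutions in $U$ of the Monge–Ampère equation $$\det(D^2v(x))=F(x,\nabla v(x)).$$ Suppose $v_2\ge v_1$ on $U$ and there is a point $x_0\in U$ such that $v_1(x_0)=v_2(x_0)$. Then $v_1=v_2$ on $U$.
   Context: A $C^2$ function $v$ is uniformly convex on $U$ if $D^2v\ge\theta I$ on $U$ for some constant $\theta>0$. *)

theory Defs
  imports "HOL-Analysis.Analysis"
begin

definition C1_on :: "'a::real_normed_vector set \<Rightarrow> ('a \<Rightarrow> 'b::real_normed_vector) \<Rightarrow> bool" where
  "C1_on S f \<longleftrightarrow>
     (\<exists>f' :: 'a \<Rightarrow> 'a \<Rightarrow>\<^sub>L 'b.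
        (\<forall>x\<in>S. (f has_derivative blinfun_apply (f' x)) (at x)) \<and> continuous_on S f')"

definition gradient :: "(real ^ 'n \<Rightarrow> real) \<Rightarrow> real ^ 'n \<Rightarrow> real ^ 'n" where
  "gradient v x = (\<chi> i. frechet_derivative v (at x) (axis i 1))"

definition C2_on :: "(real ^ 'n) set \<Rightarrow> (real ^ 'n \<Rightarrow> real) \<Rightarrow> bool" where
  "C2_on S v \<longleftrightarrow> C1_on S v \<and> C1_on S (gradient v)"

definition hessian :: "(real ^ 'n \<Rightarrow> real) \<Rightarrow> real ^ 'n \<Rightarrow> real ^ 'n ^ 'n" where
  "hessian v x = jacobian (gradient v) (at x)"

text \<open>The order on matrices given by quadratic forms. Symmetry is not required here; for
  Hessians of \<open>C\<^sup>2\<close> functions it is automatic.\<close>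

definition matrix_ge :: "real ^ 'n ^ 'n \<Rightarrow> real ^ 'n ^ 'n \<Rightarrow> bool" where
  "matrix_ge A B \<longleftrightarrow> (\<forall>\<xi>. 0 \<le> \<xi> \<bullet> ((A - B) *v \<xi>))"

definition uniformly_convex_on :: "(real ^ 'n) set \<Rightarrow> (real ^ 'n \<Rightarrow> real) \<Rightarrow> bool" where
  "uniformly_convex_on U v \<longleftrightarrow> (\<exists>\<theta>>0. \<forall>x\<in>U. matrix_ge (hessian v x) (mat \<theta>))"

definition monge_ampere_solution ::
    "(real ^ 'n) set \<Rightarrow> ((real ^ 'n) \<times> (real ^ 'n) \<Rightarrow> real) \<Rightarrow> (real ^ 'n \<Rightarrow> real) \<Rightarrow> bool" where
  "monge_ampere_solution U F v \<longleftrightarrow> (\<forall>x\<in>U. det (hessian v x) = F (x, gradient v x))"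

end

theory Submission imports Defs begin

text \<open>
  The proof is Hopf's strong maximum principle, run directly on the nonlinear equation. If the
  contact set is not open, some ball in which \<open>v1 < v2\<close> touches it at a boundary point \<open>x1\<close>, where
  the gradients agree. On the outer half of that ball, centred at \<open>y\<close>, compare \<open>v2 - v1\<close> with
  \<open>\<epsilon>(exp (-\<alpha>|x-y|\<^sup>2) - exp (-\<alpha>R\<^sup>2))\<close>. At an interior minimum of the difference the Hessian of \<open>v2\<close>
  dominates that of \<open>v1\<close> plus that of the barrier; by monotonicity of the determinant on positive
  definite matrices and the rank-one update formula, \<open>det D\<^sup>2v2 - det D\<^sup>2v1\<close> then exceeds what the
  Lipschitz bound for \<open>F\<close> in the gradient variable allows. Hence \<open>v2 - v1\<close> lies above the barrier
  and has a nonzero normal derivative at \<open>x1\<close>, a contradiction.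
\<close>

section \<open>Rank-one matrices and their effect on the determinant\<close>

definition outer :: "real ^ 'n \<Rightarrow> real ^ 'n \<Rightarrow> real ^ 'n ^ 'n" where
  "outer u v = (\<chi> i j. u $ i * v $ j)"

lemma outer_nth [simp]: "outer u v $ i $ j = u $ i * v $ j"
  by (simp add: outer_def)

lemma matrix_add_mult_distrib: "(A + B) ** C = A ** C + B ** (C :: real ^ 'n ^ 'n)"
  by (simp add: vec_eq_iff matrix_matrix_mult_def sum.distrib distrib_right)

lemma matrix_mul_outer: "A ** outer u v = outer (A *v u) v"
  by (simp add: vec_eq_iff matrix_matrix_mult_def matrix_vector_mult_def sum_distrib_right mult.assoc)

lemma outer_matrix_mul: "outer u v ** A = outer u (transpose A *v v)"
  by (simp add: vec_eq_iff matrix_matrix_mult_def matrix_vector_mult_def transpose_def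
      sum_distrib_left mult_ac)

lemma outer_mult_vec: "outer u v *v x = (v \<bullet> x) *\<^sub>R u"
  by (simp add: vec_eq_iff matrix_vector_mult_def inner_vec_def sum_distrib_left mult_ac)

lemma outer_scaleR_left: "outer (c *\<^sub>R u) v = c *\<^sub>R outer u v"
  by (simp add: vec_eq_iff)

lemma transpose_outer: "transpose (outer u v) = outer v u"
  by (simp add: vec_eq_iff transpose_def)

lemma inner_matrix_symmetric:
  fixes A :: "real ^ 'n ^ 'n"
  assumes "transpose A = A"
  shows "x \<bullet> (A *v y) = y \<bullet> (A *v x)"
  by (metis assms dot_lmul_matrix inner_commute transpose_matrix_vector)

text \<open>Conjugation by an orthogonal \<open>Q\<close> sending \<open>axis k 1\<close> to the
  direction of \<open>v\<close> turns the rank-one term into a change of column \<open>k\<close>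
  alone; Cramer's lemma then reads off the determinant.\<close>

lemma det_id_plus_outer: "det (mat 1 + outer u v) = 1 + u \<bullet> (v :: real ^ 'n)"
proof (cases "v = 0")
  case True
  then have "outer u v = 0" by (simp add: vec_eq_iff)
  then show ?thesis using True by simp
next
  case False
  fix k :: 'n
  obtain Q :: "real ^ 'n ^ 'n" where Q: "orthogonal_matrix Q" "Q *v axis k 1 = v /\<^sub>R norm v"
    using orthogonal_matrix_exists_basis[of "v /\<^sub>R norm v" k] False by auto
  have QQ: "transpose Q ** Q = mat 1" "Q ** transpose Q = mat 1"
    using Q(1) by (auto simp: orthogonal_matrix_def)
  have v: "v = norm v *\<^sub>R (Q *v axis k 1)"
    using Q(2) False by simp
  have Qv: "transpose Q *v v = norm v *\<^sub>R axis k 1"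
    by (subst v) (simp add: matrix_vector_mult_scaleR matrix_vector_mul_assoc QQ)
  define p where "p = transpose Q *v u"
  have inner: "p $ k * norm v = u \<bullet> v"
  proof -
    have "u \<bullet> v = norm v * (u \<bullet> (Q *v axis k 1))"
      by (subst v) simp
    also have "u \<bullet> (Q *v axis k 1) = p \<bullet> axis k 1"
      by (simp add: p_def dot_lmul_matrix)
    finally show ?thesis by (simp add: inner_axis mult.commute)
  qed
  have "transpose Q ** (mat 1 + outer u v) ** Q = mat 1 + outer p (norm v *\<^sub>R axis k 1)"
    by (simp add: matrix_add_ldistrib matrix_add_mult_distrib matrix_mul_outer outer_matrix_mul Qv QQ p_def
        del: transpose_matrix_vector)
  then have "det (mat 1 + outer p (norm v *\<^sub>R axis k 1)) = det (transpose Q ** Q) * det (mat 1 + outer u v)"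
    by (metis (no_types) det_mul mult.assoc mult.commute)
  then have "det (mat 1 + outer u v) = det (mat 1 + outer p (norm v *\<^sub>R axis k 1))"
    by (simp add: QQ)
  also have "mat 1 + outer p (norm v *\<^sub>R axis k 1) =
     (\<chi> i j. if j = k then (mat 1 *v (axis k 1 + norm v *\<^sub>R p)) $ i else (mat 1 :: real ^ 'n ^ 'n) $ i $ j)"
    by (auto simp: vec_eq_iff) (auto simp: mat_def axis_def)
  also have "det \<dots> = (axis k 1 + norm v *\<^sub>R p) $ k"
    by (subst cramer_lemma) simp
  finally show ?thesis using inner by (simp add: mult.commute)
qed

text \<open>Factor out \<open>A\<close>: the sum is A (I + c y w^T). The vector \<open>y\<close>
  stands for the inverse of \<open>A\<close> applied to \<open>w\<close>, given by an equation so
  that no inverse matrix appears.\<close>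

lemma det_plus_rank_one:
  fixes A :: "real ^ 'n ^ 'n"
  assumes "A *v y = w"
  shows "det (A + c *\<^sub>R outer w w) = det A * (1 + c * (w \<bullet> y))"
proof -
  have "A + c *\<^sub>R outer w w = A ** (mat 1 + outer (c *\<^sub>R y) w)"
    unfolding matrix_add_ldistrib matrix_mul_outer matrix_vector_mult_scaleR assms
    by (simp add: outer_scaleR_left)
  then show ?thesis by (simp add: det_mul det_id_plus_outer inner_commute)
qed

section \<open>Positive semidefinite matrices and monotonicity of the determinant\<close>

definition pos_semidef :: "real ^ 'n ^ 'n \<Rightarrow> bool" where
  "pos_semidef A \<longleftrightarrow> transpose A = A \<and> (\<forall>x. 0 \<le> x \<bullet> (A *v x))"

lemma pos_semidef_add: "pos_semidef A \<Longrightarrow> pos_semidef B \<Longrightarrow> pos_semidef (A + B)"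
  by (simp add: pos_semidef_def transpose_def vec_eq_iff matrix_vector_mult_add_rdistrib inner_add_right)

lemma matrix_scaleR_mult_vec: "(c *\<^sub>R A) *v x = c *\<^sub>R (A *v (x :: real ^ 'n))"
  by (simp add: scaleR_matrix_vector_assoc)

lemma pos_semidef_scaleR: "pos_semidef A \<Longrightarrow> 0 \<le> c \<Longrightarrow> pos_semidef (c *\<^sub>R A)"
  by (simp add: pos_semidef_def transpose_def vec_eq_iff matrix_scaleR_mult_vec)

lemma pos_semidef_outer: "pos_semidef (outer w w)"
  by (simp add: pos_semidef_def transpose_outer outer_mult_vec inner_commute)

lemma inner_axis_matrix: "axis i 1 \<bullet> (A *v x) = (A *v x) $ i"
  by (simp add: inner_axis')

lemma matrix_mult_axis: "((A :: real ^ 'n ^ 'n) *v axis j 1) $ i = A $ i $ j"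
  by (simp add: matrix_vector_mul_component inner_axis)

lemma pos_semidef_diag_nonneg:
  assumes "pos_semidef A" shows "0 \<le> A $ i $ i"
  using assms inner_axis_matrix[of i A "axis i 1"] by (metis matrix_mult_axis pos_semidef_def)

text \<open>One step of the Cholesky decomposition: completing the square in the \<open>k\<close>-th variable.\<close>

lemma pos_semidef_schur_complement:
  assumes P: "pos_semidef P" and k: "P $ k $ k > 0"
  shows "pos_semidef (P - (1 / P $ k $ k) *\<^sub>R outer (P *v axis k 1) (P *v axis k 1))"
  unfolding pos_semidef_def
proof (intro conjI allI)
  let ?w = "P *v axis k 1" and ?p = "P $ k $ k"
  have sym: "transpose P = P" using P by (simp add: pos_semidef_def)
  show "transpose (P - (1 / ?p) *\<^sub>R outer ?w ?w) = P - (1 / ?p) *\<^sub>R outer ?w ?w"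
    using sym by (simp add: transpose_def vec_eq_iff)
  fix x
  \<comment> \<open>This \<open>c\<close> minimises the quadratic form along x - c e_k; the minimal
    value is the form of the Schur complement at \<open>x\<close>.\<close>
  define c where "c = (x \<bullet> ?w) / ?p"
  have cp: "c * ?p = x \<bullet> ?w" using k by (simp add: c_def)
  have ww: "axis k 1 \<bullet> ?w = ?p" by (simp add: inner_axis_matrix matrix_mult_axis)
  have sx: "axis k 1 \<bullet> (P *v x) = x \<bullet> ?w"
    using inner_matrix_symmetric[OF sym] by blast
  have "0 \<le> (x - c *\<^sub>R axis k 1) \<bullet> (P *v (x - c *\<^sub>R axis k 1))"
    using P by (simp add: pos_semidef_def)
  also have "\<dots> = x \<bullet> (P *v x) - c * (x \<bullet> ?w) - c * (x \<bullet> ?w) + c * (c * ?p)"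
    by (simp add: matrix_vector_mult_diff_distrib matrix_vector_mult_scaleR inner_diff_left
        inner_diff_right ww sx algebra_simps)
  also have "\<dots> = x \<bullet> (P *v x) - c * (x \<bullet> ?w)"
    by (simp add: cp)
  also have "\<dots> = x \<bullet> ((P - (1 / ?p) *\<^sub>R outer ?w ?w) *v x)"
    by (simp add: matrix_vector_mult_diff_rdistrib matrix_scaleR_mult_vec outer_mult_vec inner_diff_right
        c_def inner_commute)
  finally show "0 \<le> x \<bullet> ((P - (1 / ?p) *\<^sub>R outer ?w ?w) *v x)" .
qed

text \<open>Along x - c e_k the quadratic form is affine in c, since its e_k coefficient vanishes. A
  nonnegative affine function has slope zero, which kills column \<open>k\<close> and, by symmetry,
  row \<open>k\<close>.\<close>

lemma pos_semidef_diag_zero: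
  assumes P: "pos_semidef P" and k: "P $ k $ k = 0"
  shows "P $ k = 0"
proof -
  have sym: "transpose P = P" using P by (simp add: pos_semidef_def)
  let ?w = "P *v axis k 1"
  have ww: "axis k 1 \<bullet> ?w = 0" by (simp add: inner_axis_matrix matrix_mult_axis k)
  have "x \<bullet> ?w = 0" for x
  proof (rule ccontr)
    assume nz: "x \<bullet> ?w \<noteq> 0"
    have sx: "axis k 1 \<bullet> (P *v x) = x \<bullet> ?w"
      using inner_matrix_symmetric[OF sym] by blast
    \<comment> \<open>Chosen so that the affine function takes the value -1.\<close>
    define c where "c = (x \<bullet> (P *v x) + 1) / (2 * (x \<bullet> ?w))"
    have "0 \<le> (x - c *\<^sub>R axis k 1) \<bullet> (P *v (x - c *\<^sub>R axis k 1))"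
      using P by (simp add: pos_semidef_def)
    also have "\<dots> = x \<bullet> (P *v x) - 2 * (c * (x \<bullet> ?w))"
      by (simp add: matrix_vector_mult_diff_distrib matrix_vector_mult_scaleR inner_diff_left
          inner_diff_right ww sx algebra_simps)
    also have "\<dots> = -1" using nz by (simp add: c_def field_simps)
    finally show False by simp
  qed
  then have "?w = 0" by (metis inner_eq_zero_iff)
  then have "P $ j $ k = 0" for j using matrix_mult_axis[of P k j] by simp
  then show ?thesis using sym by (metis (no_types) transpose_def vec_eq_iff vec_lambda_beta zero_index)
qed

text \<open>Induction on the number of nonzero rows of \<open>P\<close>. Splitting off the rank-one
  Cholesky part of a positive diagonal entry clears that row and keeps zero rows zero; adding this
  part back multiplies the determinant by a factor of at least 1.\<close>

lemma det_mono_pos_semidef: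
  fixes A :: "real ^ 'n ^ 'n"
  assumes "pos_semidef P" and "pos_semidef A" and "det A > 0"
  shows "det A \<le> det (A + P)"
  using assms(1)
proof (induction "card {i. P $ i \<noteq> 0}" arbitrary: P rule: less_induct)
  case less
  show ?case
  proof (cases "\<forall>i. P $ i $ i = 0")
    case True
    then have "P = 0"
      using pos_semidef_diag_zero[OF less.prems] by (simp add: vec_eq_iff)
    then show ?thesis by simp
  next
    case False
    then obtain k where k: "P $ k $ k > 0"
      using pos_semidef_diag_nonneg[OF less.prems] by (meson antisym_conv1 not_le order_less_le)
    define w where "w = P *v axis k 1"
    define P' where "P' = P - (1 / P $ k $ k) *\<^sub>R outer w w"
    have P': "pos_semidef P'"
      unfolding P'_def w_def by (rule pos_semidef_schur_complement[OF less.prems k])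
    have w: "w $ i = P $ i $ k" for i by (simp add: w_def matrix_mult_axis)
    have "P' $ i = 0" if "P $ i = 0" for i
      using that by (simp add: P'_def vec_eq_iff w)
    moreover have "P' $ k = 0"
    proof (rule pos_semidef_diag_zero[OF P'])
      show "P' $ k $ k = 0" using k by (simp add: P'_def w)
    qed
    moreover have "P $ k \<noteq> 0" using k by auto
    ultimately have "{i. P' $ i \<noteq> 0} \<subset> {i. P $ i \<noteq> 0}" by blast
    then have IH: "det A \<le> det (A + P')"
      using less.hyps[OF psubset_card_mono P'] by simp
    then have pos: "det (A + P') > 0" using assms(3) by simp
    then have "invertible (A + P')" by (simp add: invertible_det_nz)
    then obtain B where "(A + P') ** B = mat 1" by (auto simp: invertible_def)
    then have Bw: "(A + P') *v (B *v w) = w"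
      by (simp add: matrix_vector_mul_assoc)
    \<comment> \<open>For y = \<open>B *v w\<close> the number w . y is the quadratic form of
      \<open>A + P'\<close> at y, so the factor in the rank-one formula is at least 1.\<close>
    have "0 \<le> (B *v w) \<bullet> ((A + P') *v (B *v w))"
      using pos_semidef_add[OF assms(2) P'] by (simp add: pos_semidef_def)
    then have "0 \<le> w \<bullet> (B *v w)" by (simp add: Bw inner_commute)
    then have "1 \<le> 1 + (1 / P $ k $ k) * (w \<bullet> (B *v w))" using k by simp
    then have "det (A + P') \<le> det (A + P' + (1 / P $ k $ k) *\<^sub>R outer w w)"
      unfolding det_plus_rank_one[OF Bw]
      using pos by (metis mult_le_cancel_left1 not_less order_less_imp_le)
    also have "A + P' + (1 / P $ k $ k) *\<^sub>R outer w w = A + P"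
      by (simp add: P'_def)
    finally show ?thesis using IH by simp
  qed
qed


section \<open>Quantitative determinant bounds for elliptic matrices\<close>

lemma mat_mult_vec: "mat c *v x = c *\<^sub>R (x :: real ^ 'n)"
  by (simp add: vec_eq_iff matrix_vector_mult_def mat_def if_distrib if_distribR cong: if_cong)

lemma transpose_diff: "transpose (A - B) = transpose A - transpose (B :: real ^ 'n ^ 'm)"
  by (simp add: transpose_def vec_eq_iff)

lemma det_mat: "det (mat c :: real ^ 'n ^ 'n) = c ^ CARD('n)"
  by (subst det_diagonal) (auto simp: mat_def)

lemma det_scaleR: "det (c *\<^sub>R A) = c ^ CARD('n) * det (A :: real ^ 'n ^ 'n)"
proof -
  have "c *\<^sub>R A = mat c ** A"
    by (simp add: vec_eq_iff matrix_matrix_mult_def mat_def if_distrib if_distribR cong: if_cong)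
  then show ?thesis by (simp add: det_mul det_mat)
qed

lemma pos_semidef_mat: "0 \<le> c \<Longrightarrow> pos_semidef (mat c)"
  by (simp add: pos_semidef_def mat_mult_vec transpose_mat)

lemma pos_semidef_minus_mat:
  assumes "transpose A = A" and "\<And>x. c * (norm x)\<^sup>2 \<le> x \<bullet> (A *v x)"
  shows "pos_semidef (A - mat c)"
  using assms
  by (simp add: pos_semidef_def transpose_diff transpose_mat matrix_vector_mult_diff_rdistrib
      mat_mult_vec inner_diff_right power2_norm_eq_inner)

text \<open>Compare \<open>A\<close> with its summand \<open>mat c\<close>, the rest being
  semidefinite.\<close>

lemma det_ge_power_ellipticity:
  fixes A :: "real ^ 'n ^ 'n"
  assumes "transpose A = A" and "c > 0" and "\<And>x. c * (norm x)\<^sup>2 \<le> x \<bullet> (A *v x)"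
  shows "c ^ CARD('n) \<le> det A"
  using det_mono_pos_semidef[OF pos_semidef_minus_mat[OF assms(1,3)] pos_semidef_mat[of c]] assms(2)
  by (simp add: det_mat)

text \<open>With q = t/\<theta>, A - tI is the convex combination (1 - q) A + q (A - \<theta> I).
  Dropping the semidefinite second term leaves (1 - q)^n det A, and Bernoulli's inequality makes the
  loss linear in \<open>t\<close>.\<close>

lemma det_minus_mat_ge:
  fixes A :: "real ^ 'n ^ 'n"
  assumes sym: "transpose A = A" and "\<theta> > 0" and ell: "\<And>x. \<theta> * (norm x)\<^sup>2 \<le> x \<bullet> (A *v x)"
    and t: "0 \<le> t" "t < \<theta>"
  shows "(1 - CARD('n) * (t / \<theta>)) * det A \<le> det (A - mat t)"
proof -
  define q where "q = t / \<theta>"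
  have q: "0 \<le> q" "q < 1" "q * \<theta> = t" using t \<open>\<theta> > 0\<close> by (auto simp: q_def)
  have detA: "det A > 0"
    using det_ge_power_ellipticity[OF sym \<open>\<theta> > 0\<close> ell] \<open>\<theta> > 0\<close>
    by (meson less_le_trans zero_less_power)
  have "pos_semidef A"
    using pos_semidef_add[OF pos_semidef_minus_mat[OF sym ell] pos_semidef_mat[of \<theta>]] \<open>\<theta> > 0\<close> by simp
  then have "det ((1 - q) *\<^sub>R A) \<le> det ((1 - q) *\<^sub>R A + q *\<^sub>R (A - mat \<theta>))"
    using q detA
    by (intro det_mono_pos_semidef pos_semidef_scaleR pos_semidef_minus_mat sym ell)
       (auto simp: det_scaleR)
  also have "(1 - q) *\<^sub>R A + q *\<^sub>R (A - mat \<theta>) = A - mat t"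
    by (simp add: vec_eq_iff mat_def algebra_simps flip: q(3))
  finally have le: "(1 - q) ^ CARD('n) * det A \<le> det (A - mat t)" by (simp add: det_scaleR)
  have "1 - CARD('n) * q \<le> (1 - q) ^ CARD('n)"
    using Bernoulli_inequality[of "- q" "CARD('n)"] q by simp
  then have "(1 - CARD('n) * q) * det A \<le> (1 - q) ^ CARD('n) * det A"
    using detA by (intro mult_right_mono) auto
  then show ?thesis using le by (simp add: q_def)
qed

text \<open>Here \<open>y\<close> plays the inverse of \<open>A\<close> applied to \<open>z\<close>,
  so z . y is the quantity in the rank-one formula. Ellipticity bounds it below by |y|^2, and the
  norm bound gives |z| \<le> M |y|.\<close>

lemma inner_inverse_ge:
  fixes A :: "real ^ 'n ^ 'n"
  assumes "c \<ge> 0" "M > 0" and ell: "c * (norm y)\<^sup>2 \<le> y \<bullet> (A *v y)"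
    and bound: "norm (A *v y) \<le> M * norm y" and "A *v y = z"
  shows "c * (norm z)\<^sup>2 / M\<^sup>2 \<le> z \<bullet> y"
proof -
  have "(norm z)\<^sup>2 \<le> (M * norm y)\<^sup>2"
    using bound assms(5) by (intro power_mono) auto
  then have "(norm z)\<^sup>2 / M\<^sup>2 \<le> (norm y)\<^sup>2"
    using \<open>M > 0\<close> by (simp add: divide_le_eq power_mult_distrib mult.commute)
  then have "c * ((norm z)\<^sup>2 / M\<^sup>2) \<le> c * (norm y)\<^sup>2"
    using \<open>c \<ge> 0\<close> by (rule mult_left_mono)
  then show ?thesis using ell assms(5) by (simp add: inner_commute)
qed

text \<open>The matrix \<open>s(4\<alpha>\<^sup>2 z z\<^sup>T - 2\<alpha> I)\<close> is the Hessian of the Hopf barrier: for large \<open>\<alpha>\<close> the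
  gain in the determinant from the rank-one part beats both the loss from the multiple of the
  identity and any prescribed multiple of the gradient of the barrier, which is of order \<open>\<alpha>s\<close>.\<close>

lemma det_barrier_gain:
  fixes A B :: "real ^ 'n ^ 'n" and z :: "real ^ 'n"
  assumes symA: "transpose A = A" and symB: "transpose B = B"
    and "\<theta> > 0" and ell: "\<And>x. \<theta> * (norm x)\<^sup>2 \<le> x \<bullet> (A *v x)"
    and "M \<ge> 0" and bound: "\<And>x. norm (A *v x) \<le> M * norm x"
    and BA: "\<And>x. x \<bullet> (A *v x) + s * (4 * \<alpha>\<^sup>2 * (z \<bullet> x)\<^sup>2 - 2 * \<alpha> * (norm x)\<^sup>2) \<le> x \<bullet> (B *v x)"
    and "\<rho> \<ge> 0" and z: "\<rho> \<le> norm z" and "\<alpha> > 0" and "s > 0"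
    and s: "4 * real CARD('n) * \<alpha> * s \<le> \<theta>"
    and C: "C < \<theta> ^ CARD('n) * (\<alpha> * (\<theta> / 2 * \<rho>\<^sup>2 / (M + \<theta>)\<^sup>2) - CARD('n) / \<theta>)" and "C \<ge> 0"
  shows "det A + 2 * \<alpha> * s * C < det B"
proof -
  define n where "n = real CARD('n)"
  have n: "n \<ge> 1" by (simp add: n_def Suc_leI)
  \<comment> \<open>The barrier Hessian is 2 \<alpha> t z z^T - t I, so \<open>t\<close> measures
    the harmful identity part, and t C is the gain to be beaten.\<close>
  define t where "t = 2 * \<alpha> * s"
  \<comment> \<open>Lower bound for z . y with A' y = z: A' = A - tI keeps ellipticity \<theta>/2,
    has norm at most M + \<theta>, and |z| is at least \<rho>.\<close>
  define \<kappa> where "\<kappa> = \<theta> / 2 * \<rho>\<^sup>2 / (M + \<theta>)\<^sup>2"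
  have \<kappa>: "\<kappa> \<ge> 0" using \<open>\<theta> > 0\<close> by (simp add: \<kappa>_def)
  have t: "t > 0" "n * t \<le> \<theta> / 2"
    using s \<open>\<alpha> > 0\<close> \<open>s > 0\<close> by (auto simp: t_def n_def)
  have "1 * t \<le> n * t" using n t(1) by (intro mult_right_mono) auto
  then have t2: "t \<le> \<theta> / 2" using t by linarith
  have detA: "\<theta> ^ CARD('n) \<le> det A" "det A > 0"
    using det_ge_power_ellipticity[OF symA \<open>\<theta> > 0\<close> ell] \<open>\<theta> > 0\<close>
    by (auto intro: less_le_trans[OF zero_less_power])
  define A' where "A' = A - mat t"
  have symA': "transpose A' = A'" by (simp add: A'_def transpose_diff symA transpose_mat)
  have ell': "\<theta> / 2 * (norm x)\<^sup>2 \<le> x \<bullet> (A' *v x)" for x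
  proof -
    have "t * (norm x)\<^sup>2 \<le> \<theta> / 2 * (norm x)\<^sup>2" using t2 by (intro mult_right_mono) auto
    then show ?thesis using ell[of x]
      by (simp add: A'_def matrix_vector_mult_diff_rdistrib mat_mult_vec inner_diff_right power2_norm_eq_inner)
  qed
  have bound': "norm (A' *v x) \<le> (M + \<theta>) * norm x" for x
  proof -
    have "norm (A' *v x) \<le> norm (A *v x) + norm (t *\<^sub>R x)"
      unfolding A'_def matrix_vector_mult_diff_rdistrib mat_mult_vec by (rule norm_triangle_ineq4)
    also have "\<dots> \<le> M * norm x + \<theta> * norm x"
      using bound[of x] t(1) t2 by (intro add_mono) (auto intro!: mult_right_mono)
    finally show ?thesis by (simp add: distrib_right)
  qed
  have detA': "(1 - n * (t / \<theta>)) * det A \<le> det A'"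
    unfolding A'_def n_def using t(1) t2 \<open>\<theta> > 0\<close> by (intro det_minus_mat_ge symA ell) auto
  have nt: "n * (t / \<theta>) \<le> 1 / 2" using t(2) \<open>\<theta> > 0\<close> by (simp add: field_simps)
  have "0 < (1 - n * (t / \<theta>)) * det A" using nt detA(2) by (intro mult_pos_pos) linarith+
  then have posA': "det A' > 0" using detA' by simp
  then have "invertible A'" by (simp add: invertible_det_nz)
  then obtain E where "A' ** E = mat 1" by (auto simp: invertible_def)
  then have y: "A' *v (E *v z) = z" by (simp add: matrix_vector_mul_assoc)
  have zy: "\<kappa> \<le> z \<bullet> (E *v z)"
  proof -
    have "\<kappa> \<le> \<theta> / 2 * (norm z)\<^sup>2 / (M + \<theta>)\<^sup>2"
      unfolding \<kappa>_def using z \<open>\<rho> \<ge> 0\<close> \<open>\<theta> > 0\<close>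
      by (intro divide_right_mono mult_left_mono power_mono) auto
    also have "\<dots> \<le> z \<bullet> (E *v z)"
      using \<open>\<theta> > 0\<close> \<open>M \<ge> 0\<close> by (intro inner_inverse_ge[OF _ _ ell' bound' y]) auto
    finally show ?thesis .
  qed
  define D where "D = A' + (4 * \<alpha>\<^sup>2 * s) *\<^sub>R outer z z"
  have psA': "pos_semidef A'"
    using symA' order_trans[OF _ ell'] \<open>\<theta> > 0\<close> by (simp add: pos_semidef_def)
  have psD: "pos_semidef D"
    unfolding D_def using \<open>s > 0\<close>
    by (intro pos_semidef_add pos_semidef_scaleR psA' pos_semidef_outer) auto
  have "(1 - n * (t / \<theta>)) * det A * (1 + 4 * \<alpha>\<^sup>2 * s * \<kappa>) \<le> det A' * (1 + 4 * \<alpha>\<^sup>2 * s * (z \<bullet> (E *v z)))"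
    using detA' posA' zy \<kappa> \<open>s > 0\<close>
    by (intro mult_mono add_left_mono mult_left_mono) auto
  also have "\<dots> = det D" unfolding D_def by (simp add: det_plus_rank_one[OF y])
  finally have detD: "(1 - n * (t / \<theta>)) * det A * (1 + 4 * \<alpha>\<^sup>2 * s * \<kappa>) \<le> det D" .
  \<comment> \<open>As n t / \<theta> is at most 1/2, the cross term eats at most half of 4
    \<alpha>^2 s \<kappa> = 2 t \<alpha> \<kappa>.\<close>
  have "1 + t * (\<alpha> * \<kappa> - n / \<theta>) \<le> (1 - n * (t / \<theta>)) * (1 + 4 * \<alpha>\<^sup>2 * s * \<kappa>)"
  proof -
    have "n * (t / \<theta>) * (4 * \<alpha>\<^sup>2 * s * \<kappa>) \<le> 1 / 2 * (4 * \<alpha>\<^sup>2 * s * \<kappa>)"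
      using nt \<kappa> \<open>s > 0\<close> by (intro mult_right_mono) auto
    then show ?thesis by (simp add: t_def algebra_simps power2_eq_square)
  qed
  then have "(1 + t * (\<alpha> * \<kappa> - n / \<theta>)) * det A \<le> (1 - n * (t / \<theta>)) * (1 + 4 * \<alpha>\<^sup>2 * s * \<kappa>) * det A"
    using detA by (intro mult_right_mono) auto
  also have "\<dots> \<le> det D" using detD by (simp add: mult_ac)
  finally have "det A + t * (det A * (\<alpha> * \<kappa> - n / \<theta>)) \<le> det D" by (simp add: algebra_simps)
  moreover have "t * C < t * (det A * (\<alpha> * \<kappa> - n / \<theta>))"
  proof -
    have C': "C < \<theta> ^ CARD('n) * (\<alpha> * \<kappa> - n / \<theta>)" using C by (simp add: \<kappa>_def n_def)
    with \<open>C \<ge> 0\<close> have "0 < \<theta> ^ CARD('n) * (\<alpha> * \<kappa> - n / \<theta>)" by simp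
    \<comment> \<open>This sign allows \<theta>^n to be replaced by the larger det A.\<close>
    then have "0 < \<alpha> * \<kappa> - n / \<theta>" using \<open>\<theta> > 0\<close> by (simp add: zero_less_mult_iff)
    then have "\<theta> ^ CARD('n) * (\<alpha> * \<kappa> - n / \<theta>) \<le> det A * (\<alpha> * \<kappa> - n / \<theta>)"
      using detA by (intro mult_right_mono) auto
    then show ?thesis using C' t(1) by (intro mult_strict_left_mono) auto
  qed
  ultimately have gain: "det A + t * C < det D" by simp
  \<comment> \<open>The form of \<open>D\<close> is the left side of the hypothesis
    \<open>BA\<close>.\<close>
  have "pos_semidef (B - D)"
    unfolding pos_semidef_def
  proof (intro conjI allI)
    show "transpose (B - D) = B - D"
      using psD by (simp add: pos_semidef_def transpose_diff symB)
    show "0 \<le> x \<bullet> ((B - D) *v x)" for x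
      using BA[of x] unfolding power2_norm_eq_inner
      by (simp add: D_def A'_def t_def matrix_vector_mult_diff_rdistrib matrix_vector_mult_add_rdistrib
          matrix_scaleR_mult_vec outer_mult_vec mat_mult_vec inner_diff_right inner_add_right
          power2_eq_square inner_commute algebra_simps)
  qed
  moreover have "det D > 0" using gain detA t(1) \<open>C \<ge> 0\<close> by (smt (verit) mult_nonneg_nonneg)
  ultimately have "det D \<le> det B" using det_mono_pos_semidef[of "B - D" D] psD by simp
  then show ?thesis using gain by (simp add: t_def)
qed


section \<open>Gradients, Hessians and second-order conditions for C^2 functions\<close>

lemma linear_eq_inner_axis:
  fixes f :: "real ^ 'n \<Rightarrow> real"
  assumes "linear f"
  shows "f h = (\<chi> i. f (axis i 1)) \<bullet> h"
proof -
  have "f h = f (\<Sum>i\<in>UNIV. h $ i *\<^sub>R axis i 1)"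
    using basis_expansion[of h] by (simp add: scalar_mult_eq_scaleR)
  also have "\<dots> = (\<Sum>i\<in>UNIV. h $ i * f (axis i 1))"
    using assms by (simp add: linear_sum linear_cmul)
  finally show ?thesis by (simp add: inner_vec_def mult.commute)
qed

lemma C1_on_differentiable: "C1_on S f \<Longrightarrow> x \<in> S \<Longrightarrow> f differentiable (at x)"
  by (auto simp: C1_on_def differentiable_def)

lemma C1_on_continuous_on: "C1_on S f \<Longrightarrow> continuous_on S f"
  by (meson C1_on_differentiable continuous_at_imp_continuous_on differentiable_imp_continuous_within)

lemma C2_on_has_derivative:
  assumes "C2_on U v" and "x \<in> U"
  shows "(v has_derivative (\<lambda>h. gradient v x \<bullet> h)) (at x)"
proof -
  have D: "(v has_derivative frechet_derivative v (at x)) (at x)"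
    using assms unfolding frechet_derivative_works[symmetric] C2_on_def
    by (blast intro: C1_on_differentiable)
  then have "linear (frechet_derivative v (at x))" by (rule has_derivative_linear)
  then have "frechet_derivative v (at x) = (\<lambda>h. gradient v x \<bullet> h)"
    unfolding gradient_def by (intro ext linear_eq_inner_axis)
  then show ?thesis using D by simp
qed

lemma C2_on_gradient_has_derivative:
  assumes "C2_on U v" and "x \<in> U"
  shows "(gradient v has_derivative (\<lambda>h. hessian v x *v h)) (at x)"
  using assms unfolding hessian_def jacobian_works[symmetric]
  by (auto simp: C2_on_def C1_on_differentiable)

lemma C2_on_hessian_bounded:
  assumes "C2_on U v" and "compact K" and "K \<subseteq> U"
  obtains M where "M \<ge> 0" and "\<And>x h. x \<in> K \<Longrightarrow> norm (hessian v x *v h) \<le> M * norm h"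
proof -
  obtain f' where f': "\<And>x. x \<in> U \<Longrightarrow> (gradient v has_derivative blinfun_apply (f' x)) (at x)"
      and cont: "continuous_on U f'"
    using assms(1) by (auto simp: C2_on_def C1_on_def)
  \<comment> \<open>Uniqueness of derivatives identifies the Hessian matrix with the bounded linear
    map whose continuity is part of \<open>C1_on\<close>.\<close>
  have eq: "hessian v x *v h = f' x h" if "x \<in> U" for x h
    using has_derivative_unique[OF C2_on_gradient_has_derivative[OF assms(1) that] f'[OF that]]
    by (metis (full_types))
  have "compact (f' ` K)"
    using cont assms by (meson compact_continuous_image continuous_on_subset)
  then obtain M where M: "M > 0" "\<And>x. x \<in> K \<Longrightarrow> norm (f' x) \<le> M"
    by (metis bounded_pos compact_imp_bounded imageI)
  have "norm (hessian v x *v h) \<le> M * norm h" if "x \<in> K" for x h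
    using order_trans[OF norm_blinfun mult_right_mono[OF M(2)[OF that]]] eq[of x h] that assms(3)
    by (metis norm_ge_zero subsetD)
  with M(1) show thesis by (intro that[of M]) auto
qed

text \<open>Prepares the symmetry of the Hessian: the quotient is symmetric in \<xi> and \<eta>. The
  mean value theorem turns it into a difference of gradients, which the differentiability of
  \<open>G\<close> at \<open>a\<close> evaluates.\<close>

lemma second_difference_quotient_tendsto:
  fixes v :: "real ^ 'n \<Rightarrow> real" and A :: "real ^ 'n ^ 'n"
  assumes "open U" "a \<in> U"
    and v: "\<And>x. x \<in> U \<Longrightarrow> (v has_derivative (\<lambda>h. G x \<bullet> h)) (at x)"
    and G: "(G has_derivative (\<lambda>h. A *v h)) (at a)"
  shows "((\<lambda>t. (v (a + t *\<^sub>R \<xi> + t *\<^sub>R \<eta>) - v (a + t *\<^sub>R \<xi>) - v (a + t *\<^sub>R \<eta>) + v a) / t\<^sup>2)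
          \<longlongrightarrow> \<xi> \<bullet> (A *v \<eta>)) (at_right 0)"
proof (rule tendstoI)
  fix e :: real assume "e > 0"
  define c where "c = norm \<xi> + norm \<eta>"
  \<comment> \<open>Two linearisation errors of size e' t c, paired with \<xi>, must stay below t e;
    the +1 keeps the denominator positive.\<close>
  define e' where "e' = e / (2 * c * norm \<xi> + 1)"
  have c: "c \<ge> 0" by (simp add: c_def)
  have den: "2 * c * norm \<xi> + 1 > 0" using c by (simp add: add_nonneg_pos)
  then have e': "e' > 0" "2 * e' * c * norm \<xi> < e"
    using \<open>e > 0\<close> by (auto simp: e'_def field_simps)
  obtain d where "d > 0" and d: "\<And>y. norm (y - a) < d \<Longrightarrow> norm (G y - G a - A *v (y - a)) \<le> e' * norm (y - a)"
    using G \<open>e' > 0\<close> unfolding has_derivative_at_alt by blast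
  obtain r where "r > 0" and r: "ball a r \<subseteq> U"
    using assms(1,2) openE by blast
  \<comment> \<open>For t < b the whole parallelogram spanned by t \<xi> and t \<eta> at
    \<open>a\<close> lies in U and where the linearisation estimate holds.\<close>
  define b where "b = min d r / (c + 1)"
  have "b > 0" using \<open>d > 0\<close> \<open>r > 0\<close> c by (simp add: b_def)
  have "dist ((v (a + t *\<^sub>R \<xi> + t *\<^sub>R \<eta>) - v (a + t *\<^sub>R \<xi>) - v (a + t *\<^sub>R \<eta>) + v a) / t\<^sup>2)
          (\<xi> \<bullet> (A *v \<eta>)) < e" if t: "0 < t" "t < b" for t
  proof -
    have near: "norm (a + s *\<^sub>R \<xi> + u *\<^sub>R \<eta> - a) \<le> t * c" "t * c < d" "t * c < r"
      if "0 \<le> s" "s \<le> t" "0 \<le> u" "u \<le> t" for s u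
    proof -
      have "norm (s *\<^sub>R \<xi> + u *\<^sub>R \<eta>) \<le> norm (s *\<^sub>R \<xi>) + norm (u *\<^sub>R \<eta>)" by (rule norm_triangle_ineq)
      also have "\<dots> \<le> t * norm \<xi> + t * norm \<eta>"
        using that by (intro add_mono) (auto intro!: mult_right_mono)
      finally show "norm (a + s *\<^sub>R \<xi> + u *\<^sub>R \<eta> - a) \<le> t * c" by (simp add: c_def distrib_left add.assoc)
      have "t * c \<le> t * (c + 1)" using t by simp
      also have "\<dots> < min d r" using t c by (simp add: b_def pos_less_divide_eq)
      finally show "t * c < d" "t * c < r" by auto
    qed
    have inU: "a + s *\<^sub>R \<xi> + u *\<^sub>R \<eta> \<in> U" if "0 \<le> s" "s \<le> t" "0 \<le> u" "u \<le> t" for s u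
      using near[OF that] r by (auto simp: dist_norm norm_minus_commute subset_iff)
    define \<phi> where "\<phi> s = v (a + s *\<^sub>R \<xi> + t *\<^sub>R \<eta>) - v (a + s *\<^sub>R \<xi>)" for s
    have "(\<phi> has_real_derivative (G (a + s *\<^sub>R \<xi> + t *\<^sub>R \<eta>) - G (a + s *\<^sub>R \<xi>)) \<bullet> \<xi>) (at s)"
      if s: "0 \<le> s" "s \<le> t" for s
    proof -
      have 1: "((\<lambda>s. v (a + s *\<^sub>R \<xi> + t *\<^sub>R \<eta>)) has_derivative (\<lambda>h. G (a + s *\<^sub>R \<xi> + t *\<^sub>R \<eta>) \<bullet> (h *\<^sub>R \<xi>))) (at s)"
        using s t by (intro has_derivative_compose[OF _ v] inU) (auto intro!: derivative_eq_intros)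
      have 2: "((\<lambda>s. v (a + s *\<^sub>R \<xi>)) has_derivative (\<lambda>h. G (a + s *\<^sub>R \<xi>) \<bullet> (h *\<^sub>R \<xi>))) (at s)"
        using s t inU[of s 0] by (intro has_derivative_compose[OF _ v]) (auto intro!: derivative_eq_intros)
      show ?thesis unfolding \<phi>_def has_field_derivative_def
        by (rule has_derivative_eq_rhs[OF has_derivative_diff[OF 1 2]])
           (simp add: fun_eq_iff inner_diff_left algebra_simps)
    qed
    then have "\<exists>s>0. s < t \<and> \<phi> t - \<phi> 0 = (t - 0) * ((G (a + s *\<^sub>R \<xi> + t *\<^sub>R \<eta>) - G (a + s *\<^sub>R \<xi>)) \<bullet> \<xi>)"
      using t by (intro MVT2) auto
    then obtain s where s: "0 < s" "s < t"
        and mvt: "\<phi> t - \<phi> 0 = (t - 0) * ((G (a + s *\<^sub>R \<xi> + t *\<^sub>R \<eta>) - G (a + s *\<^sub>R \<xi>)) \<bullet> \<xi>)"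
      by blast
    define p q where "p = a + s *\<^sub>R \<xi> + t *\<^sub>R \<eta>" and "q = a + s *\<^sub>R \<xi>"
    define Rm where "Rm y = G y - G a - A *v (y - a)" for y
    have small: "norm (Rm p) \<le> e' * (t * c)" "norm (Rm q) \<le> e' * (t * c)"
    proof -
      have "norm (p - a) \<le> t * c" "t * c < d" using near[of s t] s t by (auto simp: p_def)
      then show "norm (Rm p) \<le> e' * (t * c)" unfolding Rm_def
        using d[of p] e'(1) by (smt (verit) mult_left_mono)
      have "norm (q - a) \<le> t * c" "t * c < d" using near[of s 0] s t by (auto simp: q_def)
      then show "norm (Rm q) \<le> e' * (t * c)" unfolding Rm_def
        using d[of q] e'(1) by (smt (verit) mult_left_mono)
    qed
    \<comment> \<open>The linear parts differ by t A \<eta> whatever the intermediate value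
      \<open>s\<close> is.\<close>
    have "A *v (p - a) - A *v (q - a) = t *\<^sub>R (A *v \<eta>)"
      by (simp add: p_def q_def flip: matrix_vector_mult_diff_distrib matrix_vector_mult_scaleR)
    then have "(G p - G q) \<bullet> \<xi> - t * (\<xi> \<bullet> (A *v \<eta>)) = (Rm p - Rm q) \<bullet> \<xi>"
      by (simp add: Rm_def inner_diff_left inner_commute algebra_simps)
    also have "\<bar>\<dots>\<bar> \<le> norm (Rm p - Rm q) * norm \<xi>" by (rule Cauchy_Schwarz_ineq2)
    also have "\<dots> \<le> (e' * (t * c) + e' * (t * c)) * norm \<xi>"
      using small norm_triangle_ineq4[of "Rm p" "Rm q"] by (intro mult_right_mono[OF _ norm_ge_zero]) linarith
    also have "\<dots> = t * (2 * e' * c * norm \<xi>)" by (simp add: algebra_simps)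
    also have "\<dots> < t * e" using e'(2) t by simp
    finally have "\<bar>((G p - G q) \<bullet> \<xi> - t * (\<xi> \<bullet> (A *v \<eta>))) / t\<bar> < e"
      using t by (simp add: abs_divide divide_less_eq mult.commute)
    moreover have "((G p - G q) \<bullet> \<xi> - t * (\<xi> \<bullet> (A *v \<eta>))) / t
        = t * ((G p - G q) \<bullet> \<xi>) / t\<^sup>2 - \<xi> \<bullet> (A *v \<eta>)"
      using t by (simp add: diff_divide_distrib power2_eq_square)
    moreover have "v (a + t *\<^sub>R \<xi> + t *\<^sub>R \<eta>) - v (a + t *\<^sub>R \<xi>) - v (a + t *\<^sub>R \<eta>) + v a = t * ((G p - G q) \<bullet> \<xi>)"
      using mvt by (simp add: \<phi>_def p_def q_def)
    ultimately show ?thesis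
      by (simp add: dist_real_def)
  qed
  then show "\<forall>\<^sub>F t in at_right 0. dist ((v (a + t *\<^sub>R \<xi> + t *\<^sub>R \<eta>) - v (a + t *\<^sub>R \<xi>) - v (a + t *\<^sub>R \<eta>) + v a) / t\<^sup>2)
          (\<xi> \<bullet> (A *v \<eta>)) < e"
    unfolding eventually_at_right_field using \<open>b > 0\<close> by blast
qed

text \<open>Exchanging the two directions leaves the second difference quotient unchanged, so both
  limits agree.\<close>

lemma C2_on_hessian_symmetric:
  assumes "open U" "C2_on U v" "x \<in> U"
  shows "transpose (hessian v x) = hessian v x"
proof -
  note lim = second_difference_quotient_tendsto[OF assms(1,3) C2_on_has_derivative[OF assms(2)]
      C2_on_gradient_has_derivative[OF assms(2,3)]]
  have "\<xi> \<bullet> (hessian v x *v \<eta>) = \<eta> \<bullet> (hessian v x *v \<xi>)" for \<xi> \<eta>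
    using tendsto_unique[OF _ lim[of \<xi> \<eta>]] lim[of \<eta> \<xi>] by (simp add: algebra_simps)
  from this[of "axis _ 1" "axis _ 1"] show ?thesis
    by (simp add: inner_axis_matrix matrix_mult_axis transpose_def vec_eq_iff)
qed

text \<open>If the form were negative at \<xi>, the derivative along \<xi>, zero at the minimum,
  would be negative just after it, and the mean value theorem would produce a smaller value.
  Gradient and Hessian are parameters so that the lemma fits differences with a barrier.\<close>

lemma second_order_condition_at_min:
  fixes u :: "real ^ 'n \<Rightarrow> real" and A :: "real ^ 'n ^ 'n"
  assumes "open U" "x \<in> U"
    and u: "\<And>y. y \<in> U \<Longrightarrow> (u has_derivative (\<lambda>h. G y \<bullet> h)) (at y)"
    and G: "(G has_derivative (\<lambda>h. A *v h)) (at x)"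
    and min: "\<And>y. y \<in> U \<Longrightarrow> u x \<le> u y"
  shows "G x = 0" and "0 \<le> \<xi> \<bullet> (A *v \<xi>)"
proof -
  have "(\<lambda>h. G x \<bullet> h) = (\<lambda>h. 0)"
    using differential_zero_maxmin[OF assms(2,1) u[OF assms(2)]] min by blast
  then show Gx: "G x = 0" by (metis inner_eq_zero_iff)
  show "0 \<le> \<xi> \<bullet> (A *v \<xi>)"
  proof (rule ccontr)
    assume neg: "\<not> 0 \<le> \<xi> \<bullet> (A *v \<xi>)"
    obtain r where "r > 0" and r: "ball x r \<subseteq> U" using assms(1,2) openE by blast
    define g where "g t = G (x + t *\<^sub>R \<xi>) \<bullet> \<xi>" for t
    have "((\<lambda>t. x + t *\<^sub>R \<xi>) has_derivative (\<lambda>h. h *\<^sub>R \<xi>)) (at 0)"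
      by (auto intro!: derivative_eq_intros)
    moreover have "(G has_derivative (\<lambda>h. A *v h)) (at (x + 0 *\<^sub>R \<xi>))" using G by simp
    ultimately have "((\<lambda>t. G (x + t *\<^sub>R \<xi>)) has_derivative (\<lambda>h. A *v (h *\<^sub>R \<xi>))) (at 0)"
      by (rule has_derivative_compose)
    then have "(g has_derivative (\<lambda>h. (A *v (h *\<^sub>R \<xi>)) \<bullet> \<xi>)) (at 0)"
      unfolding g_def by (rule has_derivative_inner_left)
    then have "(g has_real_derivative \<xi> \<bullet> (A *v \<xi>)) (at 0)"
      unfolding has_field_derivative_def
      by (rule back_subst[of "\<lambda>f. (g has_derivative f) (at 0)"])
         (simp add: matrix_vector_mult_scaleR inner_commute fun_eq_iff mult.commute)
    then have "\<exists>d>0. \<forall>h>0. h < d \<longrightarrow> g 0 > g (0 + h)"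
      using neg by (intro DERIV_neg_dec_right) auto
    then obtain d where "d > 0" and d: "\<And>h. 0 < h \<Longrightarrow> h < d \<Longrightarrow> g h < g 0"
      by auto
    have den: "norm \<xi> + 1 > 0" by (simp add: add_nonneg_pos)
    then have "0 < min d (r / (norm \<xi> + 1))" using \<open>d > 0\<close> \<open>r > 0\<close> by simp
    \<comment> \<open>Small enough for the segment to stay in \<open>U\<close> and for
      \<open>g\<close> to be negative on it beyond 0.\<close>
    then obtain t where t: "0 < t" "t < d" "t < r / (norm \<xi> + 1)"
      using dense by (metis min_less_iff_conj)
    then have tr: "t * (norm \<xi> + 1) < r" using den by (simp add: pos_less_divide_eq)
    have inU: "x + s *\<^sub>R \<xi> \<in> U" if "0 \<le> s" "s \<le> t" for s
    proof -
      have "s * norm \<xi> \<le> t * (norm \<xi> + 1)" using that by (intro mult_mono) auto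
      then show ?thesis using tr that r by (auto simp: dist_norm subset_iff)
    qed
    have "((\<lambda>s. u (x + s *\<^sub>R \<xi>)) has_real_derivative g s) (at s)" if "0 \<le> s" "s \<le> t" for s
    proof -
      have "((\<lambda>s. u (x + s *\<^sub>R \<xi>)) has_derivative (\<lambda>h. G (x + s *\<^sub>R \<xi>) \<bullet> (h *\<^sub>R \<xi>))) (at s)"
        using that by (intro has_derivative_compose[OF _ u] inU) (auto intro!: derivative_eq_intros)
      then show ?thesis by (simp add: has_field_derivative_def g_def mult_commute_abs)
    qed
    then have "\<exists>s>0. s < t \<and> u (x + t *\<^sub>R \<xi>) - u (x + 0 *\<^sub>R \<xi>) = (t - 0) * g s"
      using t by (intro MVT2) auto
    then obtain s where s: "0 < s" "s < t" and "u (x + t *\<^sub>R \<xi>) - u (x + 0 *\<^sub>R \<xi>) = (t - 0) * g s"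
      by blast
    moreover have "g s < 0" using d[of s] s t Gx by (simp add: g_def)
    ultimately have "u (x + t *\<^sub>R \<xi>) < u x"
      using t(1) mult_pos_neg[of t "g s"] by simp
    then show False using min[OF inU[of t]] t by simp
  qed
qed

text \<open>The derivative of \<open>F\<close> is bounded on the compact product. The mean value
  bound is applied with \<open>x\<close> fixed, so convexity is required only of the ball of
  gradients; \<open>K\<close> will be an annulus.\<close>

lemma C1_on_lipschitz_snd:
  fixes F :: "(real ^ 'n) \<times> (real ^ 'n) \<Rightarrow> real"
  assumes "C1_on (U \<times> UNIV) F" "compact K" "K \<subseteq> U"
  obtains L where "L \<ge> 0"
    and "\<And>x p q. x \<in> K \<Longrightarrow> p \<in> cball 0 P \<Longrightarrow> q \<in> cball 0 P \<Longrightarrow> \<bar>F (x, p) - F (x, q)\<bar> \<le> L * norm (p - q)"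
proof -
  obtain f' where f': "\<And>z. z \<in> U \<times> UNIV \<Longrightarrow> (F has_derivative blinfun_apply (f' z)) (at z)"
      and cont: "continuous_on (U \<times> UNIV) f'"
    using assms(1) unfolding C1_on_def by blast
  have "compact (f' ` (K \<times> cball 0 P))"
    using assms by (intro compact_continuous_image continuous_on_subset[OF cont] compact_Times) auto
  then obtain L where L: "L > 0" "\<And>z. z \<in> K \<times> cball 0 P \<Longrightarrow> norm (f' z) \<le> L"
    by (metis bounded_pos compact_imp_bounded imageI)
  have "norm (F (x, p) - F (x, q)) \<le> L * norm (p - q)"
    if x: "x \<in> K" and pq: "p \<in> cball 0 P" "q \<in> cball 0 P" for x p q
  proof (rule differentiable_bound[OF convex_cball _ _ pq])
    fix y :: "real ^ 'n" assume y: "y \<in> cball 0 P"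
    have "((\<lambda>p. F (x, p)) has_derivative (\<lambda>h. f' (x, y) (0, h))) (at y)"
      using x assms(3) by (intro has_derivative_compose[OF _ f']) (auto intro!: derivative_eq_intros)
    then show "((\<lambda>p. F (x, p)) has_derivative (\<lambda>h. f' (x, y) (0, h))) (at y within cball 0 P)"
      by (rule has_derivative_at_withinI)
    have "norm (f' (x, y)) \<le> L" using L x y by auto
    then show "onorm (\<lambda>h. f' (x, y) (0, h)) \<le> L"
      using L(1) by (intro onorm_le order_trans[OF norm_blinfun]) (auto intro!: mult_mono)
  qed
  with L(1) show thesis by (intro that[of L]) auto
qed

section \<open>The exponential barrier and the boundary point lemma\<close>

text \<open>Hopf's barrier without its additive constant -exp(-\<alpha> R^2), which returns in the
  Hopf lemma as the boundary value \<open>b\<close>. The inner product form is convenient for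
  differentiation.\<close>

definition barrier :: "real \<Rightarrow> 'a::real_inner \<Rightarrow> 'a \<Rightarrow> real" where
  "barrier \<alpha> y x = exp (- \<alpha> * ((x - y) \<bullet> (x - y)))"

lemma barrier_has_derivative:
  "(barrier \<alpha> y has_derivative (\<lambda>h. ((- 2 * \<alpha> * barrier \<alpha> y x) *\<^sub>R (x - y)) \<bullet> h)) (at x)"
  unfolding barrier_def
  by (auto intro!: derivative_eq_intros simp: fun_eq_iff inner_commute algebra_simps)

lemma barrier_gradient_has_derivative:
  fixes x y :: "real ^ 'n"
  shows "((\<lambda>x. (- 2 * \<alpha> * barrier \<alpha> y x) *\<^sub>R (x - y)) has_derivative
     (\<lambda>h. (barrier \<alpha> y x *\<^sub>R ((4 * \<alpha>\<^sup>2) *\<^sub>R outer (x - y) (x - y) - mat (2 * \<alpha>))) *v h)) (at x)"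
  by (rule derivative_eq_intros barrier_has_derivative refl)+
     (simp add: fun_eq_iff matrix_scaleR_mult_vec matrix_vector_mult_diff_rdistrib outer_mult_vec
       mat_mult_vec power2_eq_square inner_diff_left inner_diff_right algebra_simps)


lemma barrier_eq_norm: "barrier \<alpha> y x = exp (- \<alpha> * (norm (x - y))\<^sup>2)"
  by (simp add: barrier_def power2_norm_eq_inner)

text \<open>At a minimum the gradients differ by that of the barrier, so the equation allows the
  determinants to differ by at most 2 \<alpha> s L R; the second-order condition and
  \<open>det_barrier_gain\<close> force a larger difference.\<close>

lemma monge_ampere_no_barrier_contact:
  fixes v1 v2 :: "real ^ 'n \<Rightarrow> real"
  assumes U: "open U" "x \<in> U" and C2: "C2_on U v1" "C2_on U v2"
    and sol: "monge_ampere_solution U F v1" "monge_ampere_solution U F v2"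
    and "\<theta> > 0" and ell: "matrix_ge (hessian v1 x) (mat \<theta>)"
    and "M \<ge> 0" and M: "\<And>h. norm (hessian v1 x *v h) \<le> M * norm h"
    and "L \<ge> 0" and L: "\<bar>F (x, gradient v2 x) - F (x, gradient v1 x)\<bar> \<le> L * norm (gradient v2 x - gradient v1 x)"
    and "0 \<le> \<rho>" and x: "\<rho> \<le> norm (x - y)" "norm (x - y) \<le> R"
    and "\<alpha> > 0" "\<epsilon> > 0" and \<epsilon>: "4 * real CARD('n) * \<alpha> * \<epsilon> \<le> \<theta>"
    and \<alpha>: "L * R < \<theta> ^ CARD('n) * (\<alpha> * (\<theta> / 2 * \<rho>\<^sup>2 / (M + \<theta>)\<^sup>2) - CARD('n) / \<theta>)"
    and V: "open V" "x \<in> V" "V \<subseteq> U"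
    and min: "\<And>p. p \<in> V \<Longrightarrow> v2 x - v1 x - \<epsilon> * barrier \<alpha> y x \<le> v2 p - v1 p - \<epsilon> * barrier \<alpha> y p"
  shows False
proof -
  \<comment> \<open>The common scale of the gradient and the Hessian of the scaled barrier at
    \<open>x\<close>.\<close>
  define s where "s = \<epsilon> * barrier \<alpha> y x"
  define z where "z = x - y"
  define A B where "A = hessian v1 x" and "B = hessian v2 x"
  have R: "R \<ge> 0" using x order_trans[OF norm_ge_zero] by blast
  have e: "0 < barrier \<alpha> y x" "barrier \<alpha> y x \<le> 1" using \<open>\<alpha> > 0\<close> by (auto simp: barrier_def)
  then have s: "0 < s" "s \<le> \<epsilon>" using \<open>\<epsilon> > 0\<close> by (auto simp: s_def mult_le_cancel_left1)
  \<comment> \<open>\<open>g\<close> and \<open>H\<close> are the gradient and, at \<open>x\<close>,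
    the Hessian of the function being minimised.\<close>
  define g where "g p = gradient v2 p - gradient v1 p - \<epsilon> *\<^sub>R ((- 2 * \<alpha> * barrier \<alpha> y p) *\<^sub>R (p - y))" for p
  define H where "H = B - A - \<epsilon> *\<^sub>R (barrier \<alpha> y x *\<^sub>R ((4 * \<alpha>\<^sup>2) *\<^sub>R outer (x - y) (x - y) - mat (2 * \<alpha>)))"
  have der: "((\<lambda>p. v2 p - v1 p - \<epsilon> * barrier \<alpha> y p) has_derivative (\<lambda>h. g p \<bullet> h)) (at p)" if "p \<in> V" for p
  proof -
    have "p \<in> U" using that V by auto
    from has_derivative_diff[OF has_derivative_diff[OF C2_on_has_derivative[OF C2(2) this] C2_on_has_derivative[OF C2(1) this]]
        has_derivative_mult_right[OF barrier_has_derivative]]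
    show ?thesis by (rule has_derivative_eq_rhs) (simp add: g_def fun_eq_iff inner_diff_left inner_add_left)
  qed
  have der2: "(g has_derivative (\<lambda>h. H *v h)) (at x)"
    unfolding g_def
    by (rule has_derivative_eq_rhs[OF has_derivative_diff[OF has_derivative_diff[OF
          C2_on_gradient_has_derivative[OF C2(2) U(2)] C2_on_gradient_has_derivative[OF C2(1) U(2)]]
          has_derivative_scaleR_right[OF barrier_gradient_has_derivative]]])
       (simp add: H_def A_def B_def fun_eq_iff matrix_vector_mult_diff_rdistrib matrix_scaleR_mult_vec)
  note soc = second_order_condition_at_min[OF V(1,2) der der2 min]
  have grad: "gradient v2 x - gradient v1 x = (- 2 * \<alpha> * s) *\<^sub>R z"
    using soc(1) by (simp add: g_def s_def z_def mult_ac add_eq_0_iff2)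
  have "F (x, gradient v2 x) - F (x, gradient v1 x) \<le> L * norm ((- 2 * \<alpha> * s) *\<^sub>R z)"
    using L unfolding grad by linarith
  also have "\<dots> = 2 * \<alpha> * s * (L * norm z)"
    using \<open>\<alpha> > 0\<close> s by (simp add: abs_mult mult_ac)
  also have "\<dots> \<le> 2 * \<alpha> * s * (L * R)"
    using \<open>\<alpha> > 0\<close> s \<open>L \<ge> 0\<close> x by (intro mult_left_mono) (auto simp: z_def)
  finally have "det B - det A \<le> 2 * \<alpha> * s * (L * R)"
    using sol U(2) by (simp add: monge_ampere_solution_def A_def B_def)
  moreover have "det A + 2 * \<alpha> * s * (L * R) < det B"
  proof (rule det_barrier_gain[where \<theta> = \<theta> and M = M and \<rho> = \<rho> and z = z])
    show "transpose A = A" "transpose B = B"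
      using C2_on_hessian_symmetric U C2 by (auto simp: A_def B_def)
    show "\<theta> * (norm h)\<^sup>2 \<le> h \<bullet> (A *v h)" for h
      using ell by (simp add: matrix_ge_def A_def matrix_vector_mult_diff_rdistrib mat_mult_vec
          inner_diff_right power2_norm_eq_inner)
    show "norm (A *v h) \<le> M * norm h" for h using M by (simp add: A_def)
    show "h \<bullet> (A *v h) + s * (4 * \<alpha>\<^sup>2 * (z \<bullet> h)\<^sup>2 - 2 * \<alpha> * (norm h)\<^sup>2) \<le> h \<bullet> (B *v h)" for h
      using soc(2)[of h] unfolding power2_norm_eq_inner
      by (simp add: H_def s_def z_def[symmetric] matrix_vector_mult_diff_rdistrib matrix_scaleR_mult_vec
          outer_mult_vec mat_mult_vec inner_diff_right power2_eq_square inner_commute algebra_simps)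
    show "4 * real CARD('n) * \<alpha> * s \<le> \<theta>"
      using \<open>\<alpha> > 0\<close> by (intro order_trans[OF mult_left_mono[OF s(2)] \<epsilon>]) auto
  qed (use assms s R in \<open>auto simp: z_def\<close>)
  ultimately show False by simp
qed

text \<open>As \<open>x1\<close> is interior to \<open>U\<close>, contact makes the derivative of
  \<open>v2 - v1\<close> vanish there. Subtracting the barrier then gives a function strictly
  decreasing inwards at \<open>x1\<close>, although comparison on an annulus makes \<open>x1\<close>
  its minimum.\<close>

lemma monge_ampere_hopf:
  fixes v1 v2 :: "real ^ 'n \<Rightarrow> real"
  assumes U: "open U" and F: "C1_on (U \<times> UNIV) F" and C2: "C2_on U v1" "C2_on U v2"
    and uc: "uniformly_convex_on U v1"
    and sol: "monge_ampere_solution U F v1" "monge_ampere_solution U F v2"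
    and le: "\<And>x. x \<in> U \<Longrightarrow> v1 x \<le> v2 x"
    and "R > 0" and cb: "cball y R \<subseteq> U" and less: "\<And>x. x \<in> ball y R \<Longrightarrow> v1 x < v2 x"
    and x1: "norm (x1 - y) = R"
  shows "v1 x1 \<noteq> v2 x1"
proof
  assume contact: "v1 x1 = v2 x1"
  \<comment> \<open>Away from the centre |x - y| is at least R/2, which keeps the rank-one part of
    the barrier Hessian effective.\<close>
  define K where "K = cball y R - ball y (R / 2)"
  have K: "compact K" "K \<subseteq> U" using cb by (auto simp: K_def intro: compact_diff)
  have Kn: "x \<in> K \<longleftrightarrow> R / 2 \<le> norm (x - y) \<and> norm (x - y) \<le> R" for x
    by (auto simp: K_def dist_norm norm_minus_commute)
  have contv: "continuous_on U v1" "continuous_on U v2"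
      and contg: "continuous_on U (gradient v1)" "continuous_on U (gradient v2)"
    using C2 by (auto simp: C2_on_def intro: C1_on_continuous_on)
  obtain \<theta> where "\<theta> > 0" and \<theta>: "\<And>x. x \<in> U \<Longrightarrow> matrix_ge (hessian v1 x) (mat \<theta>)"
    using uc by (auto simp: uniformly_convex_on_def)
  obtain M where "M \<ge> 0" and M: "\<And>x h. x \<in> K \<Longrightarrow> norm (hessian v1 x *v h) \<le> M * norm h"
    using C2_on_hessian_bounded[OF C2(1) K] by blast
  have "compact (gradient v1 ` K \<union> gradient v2 ` K)"
    using K contg by (intro compact_Un compact_continuous_image) (auto intro: continuous_on_subset)
  then obtain P where P: "\<And>p. p \<in> gradient v1 ` K \<union> gradient v2 ` K \<Longrightarrow> norm p \<le> P"
    by (meson bounded_iff compact_imp_bounded)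
  obtain L where "L \<ge> 0" and L: "\<And>x p q. x \<in> K \<Longrightarrow> p \<in> cball 0 P \<Longrightarrow> q \<in> cball 0 P \<Longrightarrow>
      \<bar>F (x, p) - F (x, q)\<bar> \<le> L * norm (p - q)"
    using C1_on_lipschitz_snd[OF F K, of P] by blast
  define \<kappa> where "\<kappa> = \<theta> / 2 * (R / 2)\<^sup>2 / (M + \<theta>)\<^sup>2"
  have \<kappa>: "\<kappa> > 0" using \<open>\<theta> > 0\<close> \<open>M \<ge> 0\<close> \<open>R > 0\<close> by (simp add: \<kappa>_def)
  \<comment> \<open>Solves \<theta>^n (\<alpha> \<kappa> - n/\<theta>) = L R + 1; the +1 yields the
    strict inequality required for the determinant gain.\<close>
  define \<alpha> where "\<alpha> = ((L * R + 1) / \<theta> ^ CARD('n) + CARD('n) / \<theta>) / \<kappa>"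
  have \<theta>n: "\<theta> ^ CARD('n) > 0" using \<open>\<theta> > 0\<close> by simp
  have "\<alpha> > 0" unfolding \<alpha>_def
    using \<open>\<theta> > 0\<close> \<open>L \<ge> 0\<close> \<open>R > 0\<close> \<kappa> \<theta>n
    by (intro divide_pos_pos add_pos_pos add_nonneg_pos) auto
  have "\<alpha> * \<kappa> - CARD('n) / \<theta> = (L * R + 1) / \<theta> ^ CARD('n)" using \<kappa> by (simp add: \<alpha>_def)
  then have \<alpha>: "L * R < \<theta> ^ CARD('n) * (\<alpha> * \<kappa> - CARD('n) / \<theta>)" using \<open>\<theta> > 0\<close> by simp
  obtain m where "m > 0" and m: "\<And>x. x \<in> sphere y (R / 2) \<Longrightarrow> m \<le> v2 x - v1 x"
  proof -
    have sub: "sphere y (R / 2) \<subseteq> ball y R" using \<open>R > 0\<close> by auto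
    have "sphere y (R / 2) \<subseteq> U" using sub cb ball_subset_cball by blast
    then have "continuous_on (sphere y (R / 2)) (\<lambda>x. v2 x - v1 x)"
      using contv by (intro continuous_intros) (auto intro: continuous_on_subset)
    moreover have "sphere y (R / 2) \<noteq> {}" using \<open>R > 0\<close> by simp
    ultimately obtain x where "x \<in> sphere y (R / 2)" "\<And>p. p \<in> sphere y (R / 2) \<Longrightarrow> v2 x - v1 x \<le> v2 p - v1 p"
      using continuous_attains_inf[OF compact_sphere] by blast
    then show thesis using that[of "v2 x - v1 x"] less sub by force
  qed
  \<comment> \<open>The bound \<open>m\<close> makes \<open>u\<close> nonnegative on the inner
    sphere; the other bound is the smallness condition of the determinant estimate.\<close>
  define \<epsilon> where "\<epsilon> = min m (\<theta> / (4 * real CARD('n) * \<alpha>))"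
  have "\<epsilon> > 0" "\<epsilon> \<le> m" using \<open>m > 0\<close> \<open>\<theta> > 0\<close> \<open>\<alpha> > 0\<close> by (auto simp: \<epsilon>_def)
  have \<epsilon>: "4 * real CARD('n) * \<alpha> * \<epsilon> \<le> \<theta>"
  proof -
    have "\<epsilon> \<le> \<theta> / (4 * real CARD('n) * \<alpha>)" by (simp add: \<epsilon>_def)
    then show ?thesis using \<open>\<alpha> > 0\<close> by (simp add: pos_le_divide_eq mult_ac)
  qed
  define u where "u x = v2 x - v1 x - \<epsilon> * barrier \<alpha> y x" for x
  have contb: "continuous_on S (barrier \<alpha> y)" for S
    unfolding barrier_def by (intro continuous_intros)
  have contu: "continuous_on K u" unfolding u_def
    using contv K by (intro continuous_intros contb) (auto intro: continuous_on_subset)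
  have x1K: "x1 \<in> K" using x1 \<open>R > 0\<close> by (simp add: Kn)
  obtain x where xK: "x \<in> K" and xmin: "\<And>p. p \<in> K \<Longrightarrow> u x \<le> u p"
    using continuous_attains_inf[OF K(1) _ contu] x1K by blast
  define b where "b = \<epsilon> * exp (- \<alpha> * R\<^sup>2)"
  have outer_bound: "- b \<le> u p" if "norm (p - y) = R" for p
  proof -
    have "p \<in> U" using that cb by (auto simp: dist_norm norm_minus_commute)
    then show ?thesis using le[of p] that by (simp add: u_def b_def barrier_eq_norm)
  qed
  \<comment> \<open>A minimum below -b is impossible on the outer sphere, where v1 \<le> v2, on the
    inner sphere, where u \<ge> m - \<epsilon> \<ge> 0, and in between by the no-contact
    lemma.\<close>
  have ge: "- b \<le> u x"
  proof (rule ccontr)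
    assume neg: "\<not> - b \<le> u x"
    then have "norm (x - y) \<noteq> R" using outer_bound by auto
    moreover have "norm (x - y) \<noteq> R / 2"
    proof
      assume *: "norm (x - y) = R / 2"
      then have "m \<le> v2 x - v1 x" using m by (simp add: dist_norm norm_minus_commute)
      moreover have "\<epsilon> * barrier \<alpha> y x \<le> \<epsilon> * 1"
        using \<open>\<epsilon> > 0\<close> \<open>\<alpha> > 0\<close> by (intro mult_left_mono) (auto simp: barrier_def)
      moreover have "b > 0" using \<open>\<epsilon> > 0\<close> by (simp add: b_def)
      ultimately show False using neg \<open>\<epsilon> \<le> m\<close> by (simp add: u_def)
    qed
    ultimately have xint: "x \<in> ball y R - cball y (R / 2)"
      using xK by (auto simp: Kn dist_norm norm_minus_commute)
    show False
    proof (rule monge_ampere_no_barrier_contact[OF U _ C2 sol \<open>\<theta> > 0\<close> \<theta> \<open>M \<ge> 0\<close> M[OF xK] \<open>L \<ge> 0\<close>,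
          where V = "ball y R - cball y (R / 2)" and \<rho> = "R / 2" and R = R and \<alpha> = \<alpha> and \<epsilon> = \<epsilon> and y = y])
      show "\<bar>F (x, gradient v2 x) - F (x, gradient v1 x)\<bar> \<le> L * norm (gradient v2 x - gradient v1 x)"
        using P xK by (intro L) auto
      show "L * R < \<theta> ^ CARD('n) * (\<alpha> * (\<theta> / 2 * (R / 2)\<^sup>2 / (M + \<theta>)\<^sup>2) - CARD('n) / \<theta>)"
        using \<alpha> by (simp add: \<kappa>_def)
      show "v2 x - v1 x - \<epsilon> * barrier \<alpha> y x \<le> v2 p - v1 p - \<epsilon> * barrier \<alpha> y p"
        if "p \<in> ball y R - cball y (R / 2)" for p
      proof -
        have "p \<in> K" using that by (auto simp: K_def)
        then show ?thesis using xmin by (simp add: u_def)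
      qed
      show "ball y R - cball y (R / 2) \<subseteq> U" using cb by auto
    qed (use xK K xint Kn[of x] \<open>R > 0\<close> \<open>\<alpha> > 0\<close> \<open>\<epsilon> > 0\<close> \<epsilon> in auto)
  qed
  have ux1: "u x1 = - b" using contact x1 by (simp add: u_def b_def barrier_eq_norm)
  have x1U: "x1 \<in> U" using x1K K by auto
  \<comment> \<open>The inward direction, along which only the barrier contributes to the derivative
    of \<open>u\<close> at \<open>x1\<close>.\<close>
  define \<nu> where "\<nu> = y - x1"
  have v: "((\<lambda>p. v2 p - v1 p) has_derivative (\<lambda>h. (gradient v2 x1 - gradient v1 x1) \<bullet> h)) (at x1)"
    by (rule has_derivative_eq_rhs[OF has_derivative_diff[OF C2_on_has_derivative[OF C2(2) x1U]
            C2_on_has_derivative[OF C2(1) x1U]]]) (simp add: inner_diff_left)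
  have "(\<lambda>h. (gradient v2 x1 - gradient v1 x1) \<bullet> h) = (\<lambda>h. 0)"
    using differential_zero_maxmin[OF x1U U v] le contact by auto
  with v have "((\<lambda>p. v2 p - v1 p) has_derivative (\<lambda>h. 0)) (at x1)" by simp
  then have "(u has_derivative (\<lambda>h. 0 - \<epsilon> * (((- 2 * \<alpha> * barrier \<alpha> y x1) *\<^sub>R (x1 - y)) \<bullet> h))) (at x1)"
    unfolding u_def by (intro has_derivative_diff has_derivative_mult_right barrier_has_derivative)
  then have du: "(u has_derivative (\<lambda>h. - 2 * \<alpha> * b * (\<nu> \<bullet> h))) (at (x1 + 0 *\<^sub>R \<nu>))"
    using x1 by (simp add: \<nu>_def b_def barrier_eq_norm inner_diff_left algebra_simps)
  have "((\<lambda>t. x1 + t *\<^sub>R \<nu>) has_derivative (\<lambda>h. h *\<^sub>R \<nu>)) (at 0)"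
    by (auto intro!: derivative_eq_intros)
  then have "((\<lambda>t. u (x1 + t *\<^sub>R \<nu>)) has_derivative (\<lambda>h. - 2 * \<alpha> * b * (\<nu> \<bullet> (h *\<^sub>R \<nu>)))) (at 0)"
    using du by (rule has_derivative_compose)
  then have "((\<lambda>t. u (x1 + t *\<^sub>R \<nu>)) has_real_derivative (- 2 * \<alpha> * b * (\<nu> \<bullet> \<nu>))) (at 0)"
    unfolding has_field_derivative_def by (rule has_derivative_eq_rhs) (simp add: fun_eq_iff)
  moreover have "- 2 * \<alpha> * b * (\<nu> \<bullet> \<nu>) < 0"
  proof -
    have "\<nu> \<bullet> \<nu> > 0" using x1 \<open>R > 0\<close> by (auto simp: \<nu>_def)
    moreover have "b > 0" using \<open>\<epsilon> > 0\<close> by (simp add: b_def)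
    ultimately show ?thesis using \<open>\<alpha> > 0\<close> by simp
  qed
  ultimately have "\<exists>d>0. \<forall>h>0. h < d \<longrightarrow> u (x1 + 0 *\<^sub>R \<nu>) > u (x1 + (0 + h) *\<^sub>R \<nu>)"
    by (rule DERIV_neg_dec_right)
  then obtain d where "d > 0" and d: "\<And>h. 0 < h \<Longrightarrow> h < d \<Longrightarrow> u (x1 + h *\<^sub>R \<nu>) < u x1" by auto
  \<comment> \<open>The step stays within the range of decrease, and t \<le> 1/2 keeps the new
    point, at distance (1 - t) R from \<open>y\<close>, in the annulus.\<close>
  define t where "t = min d (1 / 2) / 2"
  have t: "0 < t" "t < d" "t \<le> 1 / 2" using \<open>d > 0\<close> by (auto simp: t_def)
  have "x1 + t *\<^sub>R \<nu> - y = (1 - t) *\<^sub>R (x1 - y)" by (simp add: \<nu>_def algebra_simps)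
  then have n: "norm (x1 + t *\<^sub>R \<nu> - y) = (1 - t) * R" using t x1 by simp
  have "x1 + t *\<^sub>R \<nu> \<in> K"
    unfolding Kn n using t \<open>R > 0\<close> mult_right_mono[of "1/2" "1 - t" R] by (simp add: mult_left_le_one_le)
  then show False using xmin[of "x1 + t *\<^sub>R \<nu>"] ge d[OF t(1,2)] ux1 by linarith
qed

section \<open>The contact set is open and closed\<close>

theorem lemma8p3:
  fixes U :: "(real ^ 'n) set"
    and F :: "(real ^ 'n) \<times> (real ^ 'n) \<Rightarrow> real"
    and v1 v2 :: "real ^ 'n \<Rightarrow> real"
    and x0 :: "real ^ 'n"
  assumes "open U" and "connected U"
    and "C1_on (U \<times> UNIV) F"
    and "C2_on U v1" and "C2_on U v2"
    and "uniformly_convex_on U v1" and "uniformly_convex_on U v2"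
    and "monge_ampere_solution U F v1" and "monge_ampere_solution U F v2"
    and "\<forall>x\<in>U. v1 x \<le> v2 x"
    and "x0 \<in> U" and "v1 x0 = v2 x0"
  shows "\<forall>x\<in>U. v1 x = v2 x"
proof -
  define Z where "Z = {x \<in> U. v2 x - v1 x = 0}"
  have cont: "continuous_on U (\<lambda>x. v2 x - v1 x)"
    using assms(4,5) by (intro continuous_intros) (auto simp: C2_on_def intro: C1_on_continuous_on)
  have "closedin (top_of_set U) Z"
    unfolding Z_def by (rule continuous_closedin_preimage_constant[OF cont])
  moreover have "open Z"
    unfolding open_contains_ball
  proof
    fix z assume z: "z \<in> Z"
    then obtain r' where "r' > 0" "cball z r' \<subseteq> U"
      using \<open>open U\<close> open_contains_cball unfolding Z_def by blast
    \<comment> \<open>Twice the radius is reserved so that balls of radius below \<open>r\<close>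
      about points of \<open>ball z r\<close> remain in \<open>U\<close>.\<close>
    then obtain r where "r > 0" and r: "cball z (2 * r) \<subseteq> U"
      by (metis field_sum_of_halves half_gt_zero mult_2)
    have "y \<in> Z" if y: "y \<in> ball z r" for y
    proof (rule ccontr)
      assume "y \<notin> Z"
      \<comment> \<open>Restricting to a closed ball makes the contact set closed in the whole
        space, so a point nearest to \<open>y\<close> exists.\<close>
      define C where "C = {x \<in> cball z (2 * r). v2 x - v1 x = 0}"
      have "closed C"
        unfolding C_def
        by (rule continuous_closed_preimage_constant[OF continuous_on_subset[OF cont r] closed_cball])
      moreover have zC: "z \<in> C" using z \<open>r > 0\<close> by (simp add: C_def Z_def)
      ultimately obtain x1 where x1: "x1 \<in> C" and near: "\<And>x. x \<in> C \<Longrightarrow> dist y x1 \<le> dist y x"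
        using distance_attains_inf[of C y] by blast
      \<comment> \<open>The open ball of this radius about \<open>y\<close> is free of contact and
        has the contact point \<open>x1\<close> on its sphere, as the Hopf lemma requires; R < r
        because \<open>z\<close> competes for the distance.\<close>
      define R where "R = dist y x1"
      have CZ: "C \<subseteq> Z" using r by (auto simp: C_def Z_def)
      have "R > 0" using x1 CZ \<open>y \<notin> Z\<close> by (auto simp: R_def)
      have "R < r" using near[OF zC] y by (simp add: R_def dist_commute)
      have sub: "cball y R \<subseteq> cball z (2 * r)"
      proof
        fix p assume "p \<in> cball y R"
        then show "p \<in> cball z (2 * r)"
          using y \<open>R < r\<close> dist_triangle[of z p y] by simp
      qed
      have "v1 x1 \<noteq> v2 x1"
      proof (rule monge_ampere_hopf[OF assms(1,3,4,5,6,8,9) _ \<open>R > 0\<close>, of y])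
        show "v1 x < v2 x" if "x \<in> ball y R" for x
        proof -
          have xC: "x \<in> cball z (2 * r)" using that sub ball_subset_cball by blast
          then have "v1 x \<le> v2 x" using assms(10) r by auto
          moreover have "x \<notin> C" using near[of x] that by (auto simp: R_def)
          ultimately show ?thesis using xC by (auto simp: C_def)
        qed
      qed (use assms(10) sub r in \<open>auto simp: R_def dist_norm norm_minus_commute\<close>)
      then show False using x1 by (simp add: C_def)
    qed
    then show "\<exists>e>0. ball z e \<subseteq> Z" using \<open>r > 0\<close> by blast
  qed
  then have "openin (top_of_set U) Z" by (auto simp: openin_open Z_def)
  moreover have "x0 \<in> Z" using assms(11,12) by (simp add: Z_def)
  ultimately have "Z = U" using \<open>connected U\<close> connected_clopen by blast
  then show ?thesis by (force simp: Z_def)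
qed


end
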